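(* Let $(X_n)_{n\in\mathbb{N}}$ be a sequence in $L^1_b$ and let $X\in\mathcal{H}^{\mathrm{ext}}$. Then $X_n$ converges to $X$ in $L^1$ norm if and only if the collection $\{X_n\}_{n\in\mathbb{N}}$ is uniformly integrable and $X_n$ converges to $X$ in capacity. Furthermore, in this case, the collection $\{X_n\}_{n\in\mathbb{N}}\cup\{X\}$ is also uniformly integrable and $X\in L^1_b$.
   Context: Let $(\Omega,\mathcal{F})$ be a measurable space with a discrete-time filtration $\{\mathcal{F}_t\}_{t\in\mathbb{N}}$, $\mathbb{N}=\{0,1,2,\dots\}$, such that $\mathcal{F}=\mathcal{F}_\infty=\sigma(\bigcup_t\mathcal{F}_t)$ and $\mathcal{F}_0$ is trivial. $m\mathcal{F}$, $m\mathcal{F}_t$ denote the $\mathcal{F}$-, $\mathcal{F}_t$-measurable $\mathbb{R}\cup\{\pm\infty\}$-valued functions. $\mathcal{H}$ is a linear space of $\mathcal{F}$-measurable $\mathbb{R}$-valued functions on $\Omega$ containing the constants, such that $X\in\mathcal{H}$ implies $|X|\in\mathcal{H}$ and $I_AX\in\mathcal{H}$ for all $A\in\mathcal{F}$; $\mathcal{H}_t:=\mathcal{H}\cap m\mathcal{F}_t$. $\mathcal{E}$ is an $\mathcal{SL}$-expectation: a family of maps $\mathcal{E}_t:\mathcal{H}\to\mathcal{H}_t$ such that for all $X,Y\in\mathcal{H}$, $s\le t$: (i) $X\ge Y$ implies $\mathcal{E}_t(X)\ge\mathcal{E}_t(Y)$; (ii) $\mathcal{E}_s(Y)=\mathcal{E}_s(\mathcal{E}_t(Y))$;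 (iii) $\mathcal{E}_t(I_AY)=I_A\mathcal{E}_t(Y)$ for $A\in\mathcal{F}_t$; (iv) $\mathcal{E}_t(Y)=Y$ for $Y\in\mathcal{H}_t$; (v) $\mathcal{E}_t(X+Y)\le\mathcal{E}_t(X)+\mathcal{E}_t(Y)$; (vi) $\mathcal{E}_t(\lambda Y)=\lambda^+\mathcal{E}_t(Y)+\lambda^-\mathcal{E}_t(-Y)$ for $\lambda\in\mathcal{H}_t$ with $\lambda Y\in\mathcal{H}$; (vii) if $X_i\in\mathcal{H}$ and $X_i(\omega)\downarrow0$ for every $\omega$, then $\mathcal{E}_0(X_i)\to0$. Write $\mathcal{E}=\mathcal{E}_0$ (real-valued). Such $\mathcal{E}$ has a representation $\mathcal{E}(Y)=\sup_{\theta\in\Theta}E_\theta[Y]$ for a collection $\Theta$ of ($\sigma$-additive) probability measures, which is fixed. Define $\mathcal{H}^{\mathrm{ext}}=\{X\in m\mathcal{F}:\min\{E_\theta[X^+],E_\theta[X^-]\}<\infty\ \forall\theta\in\Theta\}$ and $\mathcal{E}^{\mathrm{ext}}(X)=\sup_{\theta\in\Theta}E_\theta[X]$; this extends $\mathcal{E}$. $L^1$ is the completion of $\{X\in\mathcal{H}:\mathcal{E}(|X|)<\infty\}$ under the seminorm $\|X\|_1=\mathcal{E}(|X|)$, modulo equality in $\|\cdot\|_1$; its elements are regarded as elements of $\mathcal{H}^{\mathrm{ext}}$, and $\mathcal{E}$ extends to $L^1$ by continuity (agreeing with $\mathcal{E}^{\mathrm{ext}}$). $L^1_b\subset L^1$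 is the completion under $\|\cdot\|_1$ of the set of bounded functions in $\mathcal{H}$. Convergence of $X_n$ to $X$ in $L^1$ norm means $\mathcal{E}^{\mathrm{ext}}(|X_n-X|)\to0$. A set $K\subset L^1$ is uniformly integrable if $\mathcal{E}(I_{\{|X|\ge c\}}|X|)\to0$ uniformly in $X\in K$ as $c\to\infty$. A sequence $X_n\in\mathcal{H}^{\mathrm{ext}}$ converges in capacity to $X_\infty\in\mathcal{H}^{\mathrm{ext}}$ if for any $\epsilon,\delta>0$ there is $N\in\mathbb{N}$ with $\mathcal{E}^{\mathrm{ext}}(I_{\{|X_m-X_\infty|>\epsilon\}})<\delta$ for all $m\ge N$. *)

theory Defs
  imports "HOL-Probability.Probability"
begin

text \<open>
  Only the space and the sets of \<^term>\<open>M\<close> and \<^term>\<open>F t\<close> matter here; the measures they carry play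
  no role.  A function on \<open>\<Omega>\<close> is a HOL function considered on \<^term>\<open>space M\<close> only: order and
  equality are pointwise there, and \<open>H_cong\<close> makes \<open>H\<close> a set of functions on \<open>\<Omega>\<close>, i.e. membership
  does not depend on values outside \<open>\<Omega>\<close>.
\<close>

locale SL_expectation = filtration "space M" F
  for M :: "'a measure" and F :: "nat \<Rightarrow> 'a measure" +
  fixes H :: "('a \<Rightarrow> real) set" and E :: "nat \<Rightarrow> ('a \<Rightarrow> real) \<Rightarrow> 'a \<Rightarrow> real"
  assumes sets_M: "sets M = sigma_sets (space M) (\<Union>t. sets (F t))"
    and F0_trivial: "sets (F 0) = {{}, space M}"
    and H_measurable: "X \<in> H \<Longrightarrow> X \<in> borel_measurable M"
    and H_cong: "X \<in> H \<Longrightarrow> (\<And>\<omega>. \<omega> \<in> space M \<Longrightarrow> Y \<omega> = X \<omega>) \<Longrightarrow> Y \<in> H"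
    and H_const: "(\<lambda>_. c) \<in> H"
    and H_add: "X \<in> H \<Longrightarrow> Y \<in> H \<Longrightarrow> (\<lambda>\<omega>. X \<omega> + Y \<omega>) \<in> H"
    and H_scale: "X \<in> H \<Longrightarrow> (\<lambda>\<omega>. c * X \<omega>) \<in> H"
    and H_abs: "X \<in> H \<Longrightarrow> (\<lambda>\<omega>. \<bar>X \<omega>\<bar>) \<in> H"
    and H_indicator: "X \<in> H \<Longrightarrow> A \<in> sets M \<Longrightarrow> (\<lambda>\<omega>. indicator A \<omega> * X \<omega>) \<in> H"
    and E_range: "X \<in> H \<Longrightarrow> E t X \<in> H \<inter> borel_measurable (F t)"
    and E_mono: "X \<in> H \<Longrightarrow> Y \<in> H \<Longrightarrow> (\<forall>\<omega>\<in>space M. X \<omega> \<ge> Y \<omega>) \<Longrightarrow>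
      \<forall>\<omega>\<in>space M. E t X \<omega> \<ge> E t Y \<omega>"
    and E_tower: "Y \<in> H \<Longrightarrow> s \<le> t \<Longrightarrow> \<forall>\<omega>\<in>space M. E s Y \<omega> = E s (E t Y) \<omega>"
    and E_indicator: "Y \<in> H \<Longrightarrow> A \<in> sets (F t) \<Longrightarrow>
      \<forall>\<omega>\<in>space M. E t (\<lambda>\<omega>'. indicator A \<omega>' * Y \<omega>') \<omega> = indicator A \<omega> * E t Y \<omega>"
    and E_adapted: "Y \<in> H \<inter> borel_measurable (F t) \<Longrightarrow> \<forall>\<omega>\<in>space M. E t Y \<omega> = Y \<omega>"
    and E_subadditive: "X \<in> H \<Longrightarrow> Y \<in> H \<Longrightarrow>
      \<forall>\<omega>\<in>space M. E t (\<lambda>\<omega>'. X \<omega>' + Y \<omega>') \<omega> \<le> E t X \<omega> + E t Y \<omega>"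
    and E_homogeneous: "l \<in> H \<inter> borel_measurable (F t) \<Longrightarrow> Y \<in> H \<Longrightarrow> (\<lambda>\<omega>. l \<omega> * Y \<omega>) \<in> H \<Longrightarrow>
      \<forall>\<omega>\<in>space M. E t (\<lambda>\<omega>'. l \<omega>' * Y \<omega>') \<omega>
        = max (l \<omega>) 0 * E t Y \<omega> + max (- l \<omega>) 0 * E t (\<lambda>\<omega>'. - Y \<omega>') \<omega>"
    and E_continuous: "(\<And>i. Z i \<in> H) \<Longrightarrow>
      (\<And>\<omega>. \<omega> \<in> space M \<Longrightarrow> decseq (\<lambda>i. Z i \<omega>) \<and> (\<lambda>i. Z i \<omega>) \<longlonglongrightarrow> 0) \<Longrightarrow>
      \<forall>\<omega>\<in>space M. (\<lambda>i. E 0 (Z i) \<omega>) \<longlonglongrightarrow> 0"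

definition pos_expect :: "'a measure \<Rightarrow> ('a \<Rightarrow> ereal) \<Rightarrow> ereal" where
  "pos_expect \<theta> X = enn2ereal (\<integral>\<^sup>+\<omega>. e2ennreal (max (X \<omega>) 0) \<partial>\<theta>)"

definition expect :: "'a measure \<Rightarrow> ('a \<Rightarrow> ereal) \<Rightarrow> ereal" where
  "expect \<theta> X = pos_expect \<theta> X - pos_expect \<theta> (\<lambda>\<omega>. - X \<omega>)"

definition H_ext :: "'a measure \<Rightarrow> 'a measure set \<Rightarrow> ('a \<Rightarrow> ereal) set" where
  "H_ext M \<Theta> = {X \<in> borel_measurable M.
     \<forall>\<theta>\<in>\<Theta>. min (pos_expect \<theta> X) (pos_expect \<theta> (\<lambda>\<omega>. - X \<omega>)) < \<infinity>}"

definition E_ext :: "'a measure set \<Rightarrow> ('a \<Rightarrow> ereal) \<Rightarrow> ereal" where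
  "E_ext \<Theta> X = (SUP \<theta>\<in>\<Theta>. expect \<theta> X)"

text \<open>
  \<open>\<E>\<^sub>0(Y)\<close> is a constant function because \<^term>\<open>F 0\<close> is trivial; its value is taken at an arbitrary
  point of \<open>\<Omega>\<close>.
\<close>

locale represented_SL_expectation = SL_expectation M F H E
  for M :: "'a measure" and F H E +
  fixes \<Theta> :: "'a measure set"
  assumes prob: "\<theta> \<in> \<Theta> \<Longrightarrow> prob_space \<theta>"
    and sets_\<Theta>: "\<theta> \<in> \<Theta> \<Longrightarrow> sets \<theta> = sets M"
    and representation: "Y \<in> H \<Longrightarrow> \<omega> \<in> space M \<Longrightarrow> ereal (E 0 Y \<omega>) = E_ext \<Theta> (\<lambda>\<omega>'. ereal (Y \<omega>'))"

definition norm1 :: "'a measure set \<Rightarrow> ('a \<Rightarrow> ereal) \<Rightarrow> ereal" where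
  "norm1 \<Theta> X = E_ext \<Theta> (\<lambda>\<omega>. \<bar>X \<omega>\<bar>)"

text \<open>
  The completion of a set \<open>B\<close> of real functions, its elements being regarded as elements of
  \<^term>\<open>H_ext M \<Theta>\<close>: the functions there which are limits of Cauchy sequences in \<open>B\<close>.  Elements are
  represented by functions rather than by classes modulo \<^term>\<open>norm1 \<Theta>\<close>.  The lemma
  \<open>Cauchy_norm1_convergent\<close> below shows that every Cauchy sequence in
  \<open>H\<close> does have such a limit.

  In differences of extended functions, the library's value of \<open>\<infinity> - \<infinity>\<close> is immaterial as soon as one
  of the two functions has finite \<^term>\<open>norm1 \<Theta>\<close>, hence is finite outside a set which is null for
  every \<open>\<theta> \<in> \<Theta>\<close>.
\<close>

definition Cauchy_norm1 :: "'a measure set \<Rightarrow> (nat \<Rightarrow> 'a \<Rightarrow> real) \<Rightarrow> bool" where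
  "Cauchy_norm1 \<Theta> Y \<longleftrightarrow>
     (\<forall>\<epsilon>>0. \<exists>N. \<forall>m\<ge>N. \<forall>n\<ge>N. norm1 \<Theta> (\<lambda>\<omega>. ereal (Y m \<omega> - Y n \<omega>)) < ereal \<epsilon>)"

definition completion1 :: "'a measure \<Rightarrow> 'a measure set \<Rightarrow> ('a \<Rightarrow> real) set \<Rightarrow> ('a \<Rightarrow> ereal) set" where
  "completion1 M \<Theta> B = {X \<in> H_ext M \<Theta>. \<exists>Y. (\<forall>n. Y n \<in> B) \<and> Cauchy_norm1 \<Theta> Y \<and>
     (\<lambda>n. norm1 \<Theta> (\<lambda>\<omega>. ereal (Y n \<omega>) - X \<omega>)) \<longlonglongrightarrow> 0}"

lemma norm1_eq: "norm1 \<Theta> X = (SUP \<theta>\<in>\<Theta>. enn2ereal (\<integral>\<^sup>+\<omega>. e2ennreal \<bar>X \<omega>\<bar> \<partial>\<theta>))"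
proof -
  have "max \<bar>x\<bar> 0 = \<bar>x\<bar>" "max (- \<bar>x\<bar>) 0 = 0" for x :: ereal
    by (cases x; simp add: max_def)+
  then have "expect \<theta> (\<lambda>\<omega>. \<bar>X \<omega>\<bar>) = enn2ereal (\<integral>\<^sup>+\<omega>. e2ennreal \<bar>X \<omega>\<bar> \<partial>\<theta>)" for \<theta>
    by (simp add: expect_def pos_expect_def zero_ereal_def[symmetric] zero_ennreal.rep_eq)
  then show ?thesis by (simp add: norm1_def E_ext_def)
qed

lemma (in represented_SL_expectation) Cauchy_norm1_convergent:
  assumes "space M \<noteq> {}" and Y: "\<And>n. Y n \<in> H" and C: "Cauchy_norm1 \<Theta> Y"
  shows "\<exists>X\<in>H_ext M \<Theta>. (\<lambda>n. norm1 \<Theta> (\<lambda>\<omega>. ereal (Y n \<omega>) - X \<omega>)) \<longlonglongrightarrow> 0"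
proof -
  have ne: "\<Theta> \<noteq> {}"
    using representation[OF H_const] assms(1) by (auto simp: E_ext_def bot_ereal_def)
  have YM[measurable]: "Y n \<in> borel_measurable M" for n
    using Y H_measurable by auto
  have "\<exists>N. \<forall>m\<ge>N. \<forall>n\<ge>N. norm1 \<Theta> (\<lambda>\<omega>. ereal (Y m \<omega> - Y n \<omega>)) < ereal ((1/2)^k)" for k
    using C unfolding Cauchy_norm1_def by simp
  then obtain N where N: "\<And>k m n. m \<ge> N k \<Longrightarrow> n \<ge> N k \<Longrightarrow>
      norm1 \<Theta> (\<lambda>\<omega>. ereal (Y m \<omega> - Y n \<omega>)) < ereal ((1/2)^k)"
    by metis
  define r where "r k = (\<Sum>i\<le>k. N i)" for k
  have r_ge: "r j \<ge> N k" if "k \<le> j" for j k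
    unfolding r_def using that by (intro member_le_sum) auto
  define X where "X \<omega> = limsup (\<lambda>k. ereal (Y (r k) \<omega>))" for \<omega>
  have XM[measurable]: "X \<in> borel_measurable M"
    unfolding X_def by measurable
  have bound: "(\<integral>\<^sup>+\<omega>. ennreal \<bar>Y m \<omega> - Y n \<omega>\<bar> \<partial>\<theta>) \<le> ennreal ((1/2)^k)"
    if "\<theta> \<in> \<Theta>" "m \<ge> N k" "n \<ge> N k" for \<theta> m n k
  proof -
    have "enn2ereal (\<integral>\<^sup>+\<omega>. e2ennreal \<bar>ereal (Y m \<omega> - Y n \<omega>)\<bar> \<partial>\<theta>) \<le> ereal ((1/2)^k)"
      using N[OF that(2,3)] SUP_upper[OF that(1), of "\<lambda>\<theta>. enn2ereal (\<integral>\<^sup>+\<omega>. e2ennreal \<bar>ereal (Y m \<omega> - Y n \<omega>)\<bar> \<partial>\<theta>)"]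
      unfolding norm1_eq by (meson less_imp_le order_trans)
    then have "enn2ereal (\<integral>\<^sup>+\<omega>. e2ennreal \<bar>ereal (Y m \<omega> - Y n \<omega>)\<bar> \<partial>\<theta>) \<le> enn2ereal (ennreal ((1/2)^k))"
      by simp
    then show ?thesis by (simp add: less_eq_ennreal.rep_eq)
  qed
  have lim_AE: "AE \<omega> in \<theta>. (\<lambda>k. ereal (Y (r k) \<omega>)) \<longlonglongrightarrow> X \<omega> \<and> \<bar>X \<omega>\<bar> \<noteq> \<infinity>" if \<theta>: "\<theta> \<in> \<Theta>" for \<theta>
  proof -
    have [measurable_cong]: "sets \<theta> = sets M" using sets_\<Theta> \<theta> by simp
    let ?d = "\<lambda>k \<omega>. \<bar>Y (r (Suc k)) \<omega> - Y (r k) \<omega>\<bar>"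
    have "(\<integral>\<^sup>+\<omega>. (\<Sum>k. ennreal (?d k \<omega>)) \<partial>\<theta>) = (\<Sum>k. \<integral>\<^sup>+\<omega>. ennreal (?d k \<omega>) \<partial>\<theta>)"
      by (rule nn_integral_suminf) measurable
    also have "\<dots> \<le> (\<Sum>k. ennreal ((1/2)^k))"
      by (intro suminf_le bound \<theta> r_ge) auto
    also have "\<dots> = ennreal (\<Sum>k. (1/2)^k)"
      by (intro suminf_ennreal2) (auto intro: summable_geometric)
    also have "\<dots> < \<infinity>" by simp
    finally have fin: "(\<integral>\<^sup>+\<omega>. (\<Sum>k. ennreal (?d k \<omega>)) \<partial>\<theta>) \<noteq> \<infinity>" by simp
    have "AE \<omega> in \<theta>. (\<Sum>k. ennreal (?d k \<omega>)) \<noteq> \<infinity>"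
      by (rule nn_integral_noteq_infinite[OF _ fin]) measurable
    then show ?thesis
    proof eventually_elim
      case (elim \<omega>)
      have "summable (\<lambda>k. ?d k \<omega>)"
        using elim by (intro summable_suminf_not_top) auto
      then have "summable (\<lambda>k. Y (r (Suc k)) \<omega> - Y (r k) \<omega>)"
        by (rule summable_rabs_cancel)
      then have "convergent (\<lambda>k. Y (r k) \<omega>)"
        using sum_lessThan_telescope[of "\<lambda>k. Y (r k) \<omega>"]
        by (simp add: summable_iff_convergent convergent_diff_const_right_iff)
      then obtain l where "(\<lambda>k. Y (r k) \<omega>) \<longlonglongrightarrow> l" by (auto simp: convergent_def)
      then have l: "(\<lambda>k. ereal (Y (r k) \<omega>)) \<longlonglongrightarrow> ereal l" by simp
      then have "X \<omega> = ereal l" unfolding X_def by (intro lim_imp_Limsup) auto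
      then show ?case using l by simp
    qed
  qed
  have close: "(\<integral>\<^sup>+\<omega>. e2ennreal \<bar>ereal (Y n \<omega>) - X \<omega>\<bar> \<partial>\<theta>) \<le> ennreal ((1/2)^j)"
    if \<theta>: "\<theta> \<in> \<Theta>" and n: "n \<ge> N j" for \<theta> n j
  proof -
    have [measurable_cong]: "sets \<theta> = sets M" using sets_\<Theta> \<theta> by simp
    have "(\<integral>\<^sup>+\<omega>. e2ennreal \<bar>ereal (Y n \<omega>) - X \<omega>\<bar> \<partial>\<theta>)
        = (\<integral>\<^sup>+\<omega>. liminf (\<lambda>k. ennreal \<bar>Y n \<omega> - Y (r k) \<omega>\<bar>) \<partial>\<theta>)"
    proof (rule nn_integral_cong_AE)
      show "AE \<omega> in \<theta>. e2ennreal \<bar>ereal (Y n \<omega>) - X \<omega>\<bar> = liminf (\<lambda>k. ennreal \<bar>Y n \<omega> - Y (r k) \<omega>\<bar>)"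
        using lim_AE[OF \<theta>]
      proof eventually_elim
        case (elim \<omega>)
        then obtain l where l: "X \<omega> = ereal l" by (cases "X \<omega>") auto
        then have "(\<lambda>k. Y (r k) \<omega>) \<longlonglongrightarrow> l" using elim by simp
        then have "(\<lambda>k. ennreal \<bar>Y n \<omega> - Y (r k) \<omega>\<bar>) \<longlonglongrightarrow> ennreal \<bar>Y n \<omega> - l\<bar>"
          by (intro tendsto_intros) auto
        then have "liminf (\<lambda>k. ennreal \<bar>Y n \<omega> - Y (r k) \<omega>\<bar>) = ennreal \<bar>Y n \<omega> - l\<bar>"
          by (intro lim_imp_Liminf) auto
        then show ?case by (simp add: l)
      qed
    qed
    also have "\<dots> \<le> liminf (\<lambda>k. \<integral>\<^sup>+\<omega>. ennreal \<bar>Y n \<omega> - Y (r k) \<omega>\<bar> \<partial>\<theta>)"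
      by (rule nn_integral_liminf) measurable
    also have "\<dots> \<le> limsup (\<lambda>k. \<integral>\<^sup>+\<omega>. ennreal \<bar>Y n \<omega> - Y (r k) \<omega>\<bar> \<partial>\<theta>)"
      by (rule Liminf_le_Limsup) simp
    also have "\<dots> \<le> ennreal ((1/2)^j)"
      by (rule Limsup_bounded)
        (auto simp: eventually_sequentially intro!: exI[of _ j] bound \<theta> n r_ge)
    finally show ?thesis .
  qed
  have X_ext: "X \<in> H_ext M \<Theta>"
  proof -
    have "min (pos_expect \<theta> X) (pos_expect \<theta> (\<lambda>\<omega>. - X \<omega>)) < \<infinity>" if \<theta>: "\<theta> \<in> \<Theta>" for \<theta>
    proof -
      have [measurable_cong]: "sets \<theta> = sets M" using sets_\<Theta> \<theta> by simp
      have sp: "space \<theta> = space M" by (rule sets_eq_imp_space_eq[OF sets_\<Theta>[OF \<theta>]])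
      let ?n = "N 0"
      obtain \<omega>0 where \<omega>0: "\<omega>0 \<in> space M"
        using prob_space.not_empty[OF prob[OF \<theta>]] sp by auto
      have "norm1 \<Theta> (\<lambda>\<omega>. ereal (Y ?n \<omega>)) = ereal (E 0 (\<lambda>\<omega>. \<bar>Y ?n \<omega>\<bar>) \<omega>0)"
        using representation[OF H_abs[OF Y[of ?n]] \<omega>0] by (simp add: norm1_def)
      then have "enn2ereal (\<integral>\<^sup>+\<omega>. e2ennreal \<bar>ereal (Y ?n \<omega>)\<bar> \<partial>\<theta>) < \<infinity>"
        using SUP_upper[OF \<theta>, of "\<lambda>\<theta>. enn2ereal (\<integral>\<^sup>+\<omega>. e2ennreal \<bar>ereal (Y ?n \<omega>)\<bar> \<partial>\<theta>)"]
        unfolding norm1_eq by (auto intro: le_less_trans)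
      then have fin: "(\<integral>\<^sup>+\<omega>. e2ennreal \<bar>ereal (Y ?n \<omega>)\<bar> \<partial>\<theta>) < \<infinity>"
        by (simp add: less_ennreal.rep_eq)
      have "(\<integral>\<^sup>+\<omega>. e2ennreal (max (X \<omega>) 0) \<partial>\<theta>)
          \<le> (\<integral>\<^sup>+\<omega>. e2ennreal \<bar>ereal (Y ?n \<omega>) - X \<omega>\<bar> + e2ennreal \<bar>ereal (Y ?n \<omega>)\<bar> \<partial>\<theta>)"
      proof (rule nn_integral_mono)
        fix \<omega>
        have "max (X \<omega>) 0 \<le> \<bar>ereal (Y ?n \<omega>) - X \<omega>\<bar> + \<bar>ereal (Y ?n \<omega>)\<bar>"
          by (cases "X \<omega>") (auto simp: max_def)
        then have "e2ennreal (max (X \<omega>) 0) \<le> e2ennreal (\<bar>ereal (Y ?n \<omega>) - X \<omega>\<bar> + \<bar>ereal (Y ?n \<omega>)\<bar>)"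
          by (rule e2ennreal_mono)
        also have "\<dots> = e2ennreal \<bar>ereal (Y ?n \<omega>) - X \<omega>\<bar> + e2ennreal \<bar>ereal (Y ?n \<omega>)\<bar>"
          by (rule plus_ennreal.abs_eq[symmetric]) (auto simp: eq_onp_def)
        finally show "e2ennreal (max (X \<omega>) 0)
          \<le> e2ennreal \<bar>ereal (Y ?n \<omega>) - X \<omega>\<bar> + e2ennreal \<bar>ereal (Y ?n \<omega>)\<bar>" .
      qed
      also have "\<dots> = (\<integral>\<^sup>+\<omega>. e2ennreal \<bar>ereal (Y ?n \<omega>) - X \<omega>\<bar> \<partial>\<theta>) + (\<integral>\<^sup>+\<omega>. e2ennreal \<bar>ereal (Y ?n \<omega>)\<bar> \<partial>\<theta>)"
        by (rule nn_integral_add) measurable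
      also have "\<dots> < \<infinity>"
        using fin close[OF \<theta>, of 0 ?n] by (auto simp: le_less_trans)
      finally have "pos_expect \<theta> X < \<infinity>"
        by (simp add: pos_expect_def less_ennreal.rep_eq)
      then show ?thesis by (rule min.strict_coboundedI1)
    qed
    then show ?thesis by (auto simp: H_ext_def)
  qed
  have "(\<lambda>n. norm1 \<Theta> (\<lambda>\<omega>. ereal (Y n \<omega>) - X \<omega>)) \<longlonglongrightarrow> 0"
  proof (rule order_tendstoI)
    fix a :: ereal assume "a < 0"
    moreover have "0 \<le> norm1 \<Theta> (\<lambda>\<omega>. ereal (Y n \<omega>) - X \<omega>)" for n
      using ne unfolding norm1_eq by (auto intro: SUP_upper2)
    ultimately show "\<forall>\<^sub>F n in sequentially. a < norm1 \<Theta> (\<lambda>\<omega>. ereal (Y n \<omega>) - X \<omega>)"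
      by (auto intro: always_eventually less_le_trans)
  next
    fix a :: ereal assume "0 < a"
    then obtain e where e: "0 < ereal e" "ereal e < a" using ereal_dense2 by blast
    then obtain j where j: "(1/2::real)^j < e" using real_arch_pow_inv[of e "1/2"] by auto
    have "norm1 \<Theta> (\<lambda>\<omega>. ereal (Y n \<omega>) - X \<omega>) < a" if "n \<ge> N j" for n
    proof -
      have "enn2ereal (\<integral>\<^sup>+\<omega>. e2ennreal \<bar>ereal (Y n \<omega>) - X \<omega>\<bar> \<partial>\<theta>) \<le> ereal ((1/2)^j)" if "\<theta> \<in> \<Theta>" for \<theta>
        using close[OF that \<open>n \<ge> N j\<close>] by (simp add: less_eq_ennreal.rep_eq)
      then have "norm1 \<Theta> (\<lambda>\<omega>. ereal (Y n \<omega>) - X \<omega>) \<le> ereal ((1/2)^j)"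
        unfolding norm1_eq by (rule SUP_least)
      also have "\<dots> < ereal e" using j by simp
      finally show ?thesis using e by simp
    qed
    then show "\<forall>\<^sub>F n in sequentially. norm1 \<Theta> (\<lambda>\<omega>. ereal (Y n \<omega>) - X \<omega>) < a"
      by (auto simp: eventually_sequentially)
  qed
  with X_ext show ?thesis by blast
qed

definition L1 :: "'a measure \<Rightarrow> 'a measure set \<Rightarrow> ('a \<Rightarrow> real) set \<Rightarrow> ('a \<Rightarrow> ereal) set" where
  "L1 M \<Theta> H = completion1 M \<Theta> {X \<in> H. norm1 \<Theta> (\<lambda>\<omega>. ereal (X \<omega>)) < \<infinity>}"

definition L1b :: "'a measure \<Rightarrow> 'a measure set \<Rightarrow> ('a \<Rightarrow> real) set \<Rightarrow> ('a \<Rightarrow> ereal) set" where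
  "L1b M \<Theta> H = completion1 M \<Theta> {X \<in> H. \<exists>C. \<forall>\<omega>\<in>space M. \<bar>X \<omega>\<bar> \<le> C}"

definition converges_in_L1 :: "'a measure set \<Rightarrow> (nat \<Rightarrow> 'a \<Rightarrow> ereal) \<Rightarrow> ('a \<Rightarrow> ereal) \<Rightarrow> bool" where
  "converges_in_L1 \<Theta> X Z \<longleftrightarrow> (\<lambda>n. norm1 \<Theta> (\<lambda>\<omega>. X n \<omega> - Z \<omega>)) \<longlonglongrightarrow> 0"

definition unif_integrable ::
  "'a measure \<Rightarrow> 'a measure set \<Rightarrow> ('a \<Rightarrow> real) set \<Rightarrow> ('a \<Rightarrow> ereal) set \<Rightarrow> bool" where
  "unif_integrable M \<Theta> H K \<longleftrightarrow> K \<subseteq> L1 M \<Theta> H \<and>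
     (\<forall>\<epsilon>>0. \<exists>c0::real. \<forall>c\<ge>c0. \<forall>X\<in>K.
        E_ext \<Theta> (\<lambda>\<omega>. indicator {\<omega> \<in> space M. \<bar>X \<omega>\<bar> \<ge> ereal c} \<omega> * \<bar>X \<omega>\<bar>) < ereal \<epsilon>)"

definition converges_in_capacity ::
  "'a measure \<Rightarrow> 'a measure set \<Rightarrow> (nat \<Rightarrow> 'a \<Rightarrow> ereal) \<Rightarrow> ('a \<Rightarrow> ereal) \<Rightarrow> bool" where
  "converges_in_capacity M \<Theta> X Z \<longleftrightarrow>
     (\<forall>\<epsilon>>0. \<forall>\<delta>>0. \<exists>N. \<forall>m\<ge>N.
        E_ext \<Theta> (indicator {\<omega> \<in> space M. \<bar>X m \<omega> - Z \<omega>\<bar> > ereal \<epsilon>}) < ereal \<delta>)"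

end

theory Submission
  imports Defs
begin

text \<open>
  Everything is estimated uniformly over \<open>\<theta>\<close>.  A family which, for every \<open>\<epsilon>\<close>, is within \<open>\<epsilon>\<close> of
  functions in \<open>H\<close> sharing one bound \<open>C\<close> is uniformly integrable, because \<open>|Y| \<le> C \<le> |X|/2\<close> forces
  \<open>|X| \<le> 2|Y - X|\<close>; together with Markov's inequality this gives the forward direction.  Conversely,
  uniform integrability and convergence in capacity make \<open>X\<^sub>n\<close> Cauchy.  The limit is identified
  through \<open>min |X\<^sub>n - Z| k \<le> |X\<^sub>n - X\<^sub>m| + \<epsilon> + k I{|X\<^sub>m - Z| > \<epsilon>}\<close>, letting first \<open>m\<close> and then \<open>k\<close>
  tend to infinity, so that no integrability of \<open>Z\<close> is needed in advance.
\<close>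

section \<open>Upper integrals in \<open>ennreal\<close> and their relation to the seminorm\<close>

text \<open>For nonnegative integrands the supremum can be taken in \<open>ennreal\<close>, where
  sums and monotone limits of integrals raise no question about \<infinity> - \<infinity>. Over an
  empty \<Theta> it is 0, whereas the \<open>ereal\<close> supremum is -\<infinity>; this is why the
  comparison with \<open>norm1\<close> assumes \<Theta> nonempty.\<close>

definition upper_int :: "'a measure set \<Rightarrow> ('a \<Rightarrow> ennreal) \<Rightarrow> ennreal" where
  "upper_int \<Theta> f = (SUP \<theta>\<in>\<Theta>. \<integral>\<^sup>+\<omega>. f \<omega> \<partial>\<theta>)"

abbreviation ennabs :: "ereal \<Rightarrow> ennreal" where
  "ennabs x \<equiv> e2ennreal \<bar>x\<bar>"

text \<open>In \<open>ereal\<close> a difference with an infinite argument has infinite absolute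
  value, even \<infinity> - \<infinity>. So one infinite argument already makes the right side
  infinite, and the inequality holds for all extended values.\<close>

lemma ennabs_diff_triangle: "ennabs (x - z) \<le> ennabs (x - y) + ennabs (y - z)"
  by (cases x; cases y; cases z)
    (auto simp: ennreal_plus[symmetric] e2ennreal_infty simp del: ennreal_plus intro!: ennreal_leI)

lemma ennabs_diff_commute: "ennabs (x - y) = ennabs (y - x)"
  by (cases x; cases y) auto

lemma norm1_eq_upper_int:
  assumes "\<Theta> \<noteq> {}"
  shows "norm1 \<Theta> X = enn2ereal (upper_int \<Theta> (\<lambda>\<omega>. ennabs (X \<omega>)))"
proof (rule antisym)
  show "norm1 \<Theta> X \<le> enn2ereal (upper_int \<Theta> (\<lambda>\<omega>. ennabs (X \<omega>)))"
    unfolding norm1_eq upper_int_def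
    by (intro SUP_least) (auto simp: less_eq_ennreal.rep_eq[symmetric] intro: SUP_upper)
  \<comment> \<open>\<open>e2ennreal\<close> truncates negative values, so passing back to
    \<open>ereal\<close> requires the seminorm to be nonnegative, which a single \<theta>
    ensures.\<close>
  have nn: "0 \<le> norm1 \<Theta> X"
    using assms unfolding norm1_eq by (auto intro: SUP_upper2)
  have "upper_int \<Theta> (\<lambda>\<omega>. ennabs (X \<omega>)) \<le> e2ennreal (norm1 \<Theta> X)"
    unfolding upper_int_def
  proof (rule SUP_least)
    fix \<theta> assume "\<theta> \<in> \<Theta>"
    then have "enn2ereal (\<integral>\<^sup>+\<omega>. ennabs (X \<omega>) \<partial>\<theta>) \<le> norm1 \<Theta> X"
      unfolding norm1_eq by (rule SUP_upper)
    then show "(\<integral>\<^sup>+\<omega>. ennabs (X \<omega>) \<partial>\<theta>) \<le> e2ennreal (norm1 \<Theta> X)"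
      using e2ennreal_mono by fastforce
  qed
  then show "enn2ereal (upper_int \<Theta> (\<lambda>\<omega>. ennabs (X \<omega>))) \<le> norm1 \<Theta> X"
    using nn by (simp add: less_eq_ennreal.rep_eq enn2ereal_e2ennreal)
qed

lemma norm1_less_iff:
  assumes "\<Theta> \<noteq> {}" "0 \<le> e"
  shows "norm1 \<Theta> X < ereal e \<longleftrightarrow> upper_int \<Theta> (\<lambda>\<omega>. ennabs (X \<omega>)) < ennreal e"
  using assms by (simp add: norm1_eq_upper_int less_ennreal.rep_eq)

lemma E_ext_eq_norm1:
  assumes "\<And>\<omega>. 0 \<le> X \<omega>"
  shows "E_ext \<Theta> X = norm1 \<Theta> X"
  using assms by (simp add: norm1_def)

lemma norm1_tendsto_0_iff:
  assumes "\<Theta> \<noteq> {}"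
  shows "(\<lambda>n. norm1 \<Theta> (W n)) \<longlonglongrightarrow> 0 \<longleftrightarrow>
    (\<forall>\<epsilon>>0. \<exists>N. \<forall>n\<ge>N. upper_int \<Theta> (\<lambda>\<omega>. ennabs (W n \<omega>)) < ennreal \<epsilon>)" (is "?L \<longleftrightarrow> ?R")
proof
  assume ?L
  show ?R
  proof (intro allI impI)
    fix \<epsilon> :: real assume "\<epsilon> > 0"
    then have "\<forall>\<^sub>F n in sequentially. norm1 \<Theta> (W n) < ereal \<epsilon>"
      using order_tendstoD(2)[OF \<open>?L\<close>, of "ereal \<epsilon>"] by simp
    then show "\<exists>N. \<forall>n\<ge>N. upper_int \<Theta> (\<lambda>\<omega>. ennabs (W n \<omega>)) < ennreal \<epsilon>"
      using \<open>\<epsilon> > 0\<close> by (simp add: norm1_less_iff[OF assms] eventually_sequentially)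
  qed
next
  assume R: ?R
  show ?L
  proof (rule order_tendstoI)
    fix a :: ereal assume "a < 0"
    then show "\<forall>\<^sub>F n in sequentially. a < norm1 \<Theta> (W n)"
      by (auto simp: norm1_eq_upper_int[OF assms] intro!: always_eventually less_le_trans[OF _ enn2ereal_nonneg])
  next
    fix a :: ereal assume "0 < a"
    then obtain e where e: "0 < ereal e" "ereal e < a" using ereal_dense2 by blast
    then obtain N where "\<forall>n\<ge>N. upper_int \<Theta> (\<lambda>\<omega>. ennabs (W n \<omega>)) < ennreal e"
      using R by auto
    then have "\<forall>n\<ge>N. norm1 \<Theta> (W n) < ereal e"
      using e by (simp add: norm1_less_iff[OF assms])
    then show "\<forall>\<^sub>F n in sequentially. norm1 \<Theta> (W n) < a"
      using e(2) by (auto simp: eventually_sequentially intro: less_trans)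
  qed
qed

lemma ennreal_half_add_less:
  assumes "a < ennreal (\<epsilon> / 2)" "b < ennreal (\<epsilon> / 2)"
  shows "a + b < ennreal \<epsilon>"
proof -
  \<comment> \<open>\<open>ennreal\<close> sends nonpositive reals to 0, and nothing lies strictly
    below 0.\<close>
  have "\<epsilon> > 0" using assms(1) by (cases "\<epsilon> > 0") (auto simp: ennreal_neg)
  have "a + b < ennreal (\<epsilon> / 2) + ennreal (\<epsilon> / 2)"
    by (rule add_strict_mono[OF assms])
  also have "\<dots> = ennreal \<epsilon>" using \<open>\<epsilon> > 0\<close> by (simp flip: ennreal_plus)
  finally show ?thesis .
qed

section \<open>Calculus of the upper integral\<close>

context represented_SL_expectation
begin

lemma space_\<Theta>: "\<theta> \<in> \<Theta> \<Longrightarrow> space \<theta> = space M"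
  by (rule sets_eq_imp_space_eq[OF sets_\<Theta>])

lemma upper_int_mono:
  assumes "\<And>\<omega>. \<omega> \<in> space M \<Longrightarrow> f \<omega> \<le> g \<omega>"
  shows "upper_int \<Theta> f \<le> upper_int \<Theta> g"
  unfolding upper_int_def using assms
  by (intro SUP_subset_mono order_refl nn_integral_mono) (auto simp: space_\<Theta>)

text \<open>Additivity weakens to an inequality, since the two suprema may be approached along
  different \<theta>.\<close>

lemma upper_int_add_le:
  assumes "f \<in> borel_measurable M" "g \<in> borel_measurable M"
  shows "upper_int \<Theta> (\<lambda>\<omega>. f \<omega> + g \<omega>) \<le> upper_int \<Theta> f + upper_int \<Theta> g"
  unfolding upper_int_def
proof (rule SUP_least)
  fix \<theta> assume \<theta>: "\<theta> \<in> \<Theta>"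
  have "(\<integral>\<^sup>+\<omega>. f \<omega> + g \<omega> \<partial>\<theta>) = (\<integral>\<^sup>+\<omega>. f \<omega> \<partial>\<theta>) + (\<integral>\<^sup>+\<omega>. g \<omega> \<partial>\<theta>)"
    using assms sets_\<Theta>[OF \<theta>] by (intro nn_integral_add) (auto cong: measurable_cong_sets)
  also have "\<dots> \<le> (SUP \<theta>\<in>\<Theta>. \<integral>\<^sup>+\<omega>. f \<omega> \<partial>\<theta>) + (SUP \<theta>\<in>\<Theta>. \<integral>\<^sup>+\<omega>. g \<omega> \<partial>\<theta>)"
    by (intro add_mono SUP_upper \<theta>)
  finally show "(\<integral>\<^sup>+\<omega>. f \<omega> + g \<omega> \<partial>\<theta>) \<le> \<dots>" .
qed

lemma upper_int_cmult:
  assumes "f \<in> borel_measurable M"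
  shows "upper_int \<Theta> (\<lambda>\<omega>. c * f \<omega>) = c * upper_int \<Theta> f"
proof -
  have "(\<integral>\<^sup>+\<omega>. c * f \<omega> \<partial>\<theta>) = c * (\<integral>\<^sup>+\<omega>. f \<omega> \<partial>\<theta>)" if "\<theta> \<in> \<Theta>" for \<theta>
    using assms sets_\<Theta>[OF that] by (intro nn_integral_cmult) (auto cong: measurable_cong_sets)
  then show ?thesis
    by (simp add: upper_int_def SUP_mult_left_ennreal)
qed

lemma upper_int_const_le: "upper_int \<Theta> (\<lambda>_. c) \<le> c"
  unfolding upper_int_def
  by (intro SUP_least) (simp add: prob_space.emeasure_space_1 prob)

text \<open>Monotone convergence applies under each \<theta> separately, and a bound uniform in
  \<theta> passes to the supremum. It serves to remove a truncation.\<close>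

lemma upper_int_SUP_le:
  assumes "\<And>k. f k \<in> borel_measurable M" "\<And>\<omega>. incseq (\<lambda>k. f k \<omega>)" "\<And>k::nat. upper_int \<Theta> (f k) \<le> b"
  shows "upper_int \<Theta> (\<lambda>\<omega>. SUP k. f k \<omega>) \<le> b"
  unfolding upper_int_def
proof (rule SUP_least)
  fix \<theta> assume \<theta>: "\<theta> \<in> \<Theta>"
  have "(\<integral>\<^sup>+\<omega>. (SUP k. f k \<omega>) \<partial>\<theta>) = (SUP k. \<integral>\<^sup>+\<omega>. f k \<omega> \<partial>\<theta>)"
    using assms(1,2) sets_\<Theta>[OF \<theta>]
    by (intro nn_integral_monotone_convergence_SUP)
      (auto cong: measurable_cong_sets simp: incseq_def le_fun_def)
  also have "\<dots> \<le> b"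
  proof (rule SUP_least)
    fix k
    have "(\<integral>\<^sup>+\<omega>. f k \<omega> \<partial>\<theta>) \<le> upper_int \<Theta> (f k)"
      unfolding upper_int_def by (rule SUP_upper[OF \<theta>])
    then show "(\<integral>\<^sup>+\<omega>. f k \<omega> \<partial>\<theta>) \<le> b" using assms(3) order_trans by blast
  qed
  finally show "(\<integral>\<^sup>+\<omega>. (SUP k. f k \<omega>) \<partial>\<theta>) \<le> b" .
qed

section \<open>Distances and approximation by functions in \<open>H\<close>\<close>

text \<open>For measurable arguments a finite distance forces both to be finite almost surely under
  every \<theta>, because an infinite value makes the difference infinite.\<close>

abbreviation dist1 :: "('a \<Rightarrow> ereal) \<Rightarrow> ('a \<Rightarrow> ereal) \<Rightarrow> ennreal" where
  "dist1 X Y \<equiv> upper_int \<Theta> (\<lambda>\<omega>. ennabs (X \<omega> - Y \<omega>))"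

lemma dist1_commute: "dist1 X Y = dist1 Y X"
  by (simp add: ennabs_diff_commute)

lemma dist1_triangle:
  assumes [measurable]: "X \<in> borel_measurable M" "Y \<in> borel_measurable M" "Z \<in> borel_measurable M"
  shows "dist1 X Z \<le> dist1 X Y + dist1 Y Z"
proof -
  have "dist1 X Z \<le> upper_int \<Theta> (\<lambda>\<omega>. ennabs (X \<omega> - Y \<omega>) + ennabs (Y \<omega> - Z \<omega>))"
    by (intro upper_int_mono ennabs_diff_triangle)
  also have "\<dots> \<le> dist1 X Y + dist1 Y Z"
    by (rule upper_int_add_le) measurable
  finally show ?thesis .
qed

lemma dist1_triangle_less:
  assumes "X \<in> borel_measurable M" "Y \<in> borel_measurable M" "Z \<in> borel_measurable M"
    and "dist1 X Y < ennreal (\<epsilon> / 2)" "dist1 Y Z < ennreal (\<epsilon> / 2)"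
  shows "dist1 X Z < ennreal \<epsilon>"
  using dist1_triangle[OF assms(1-3)] ennreal_half_add_less[OF assms(4,5)] by (rule le_less_trans)

text \<open>Trades sequences for one approximant per \<epsilon>. Conversely, approximants within
  1/(n+1) of \<open>Z\<close> converge to \<open>Z\<close>, and the triangle inequality through
  \<open>Z\<close> makes them Cauchy.\<close>

lemma completion1_iff:
  assumes ne: "\<Theta> \<noteq> {}" and B: "B \<subseteq> H"
  shows "Z \<in> completion1 M \<Theta> B \<longleftrightarrow>
    Z \<in> H_ext M \<Theta> \<and> (\<forall>\<epsilon>>0. \<exists>Y\<in>B. dist1 (\<lambda>\<omega>. ereal (Y \<omega>)) Z < ennreal \<epsilon>)" (is "?L \<longleftrightarrow> ?R")
proof
  assume ?L
  then show ?R
    unfolding completion1_def by (auto simp: norm1_tendsto_0_iff[OF ne]) (metis order_refl)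
next
  assume R: ?R
  then have ZM: "Z \<in> borel_measurable M" by (simp add: H_ext_def)
  have "\<forall>n. \<exists>Y\<in>B. dist1 (\<lambda>\<omega>. ereal (Y \<omega>)) Z < ennreal (1 / Suc n)"
    using R by simp
  then obtain Y where YB: "\<And>n. Y n \<in> B"
    and Y: "\<And>n. dist1 (\<lambda>\<omega>. ereal (Y n \<omega>)) Z < ennreal (1 / Suc n)"
    by metis
  have YM: "(\<lambda>\<omega>. ereal (Y n \<omega>)) \<in> borel_measurable M" for n
    using YB[of n] B H_measurable by (intro borel_measurable_ereal) auto
  have lim: "\<exists>N. \<forall>n\<ge>N. dist1 (\<lambda>\<omega>. ereal (Y n \<omega>)) Z < ennreal \<epsilon>" if "\<epsilon> > 0" for \<epsilon>
  proof -
    obtain N where N: "1 / Suc N < \<epsilon>" using nat_approx_posE \<open>\<epsilon> > 0\<close> by metis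
    have "dist1 (\<lambda>\<omega>. ereal (Y n \<omega>)) Z < ennreal \<epsilon>" if "n \<ge> N" for n
    proof -
      have "1 / Suc n \<le> 1 / Suc N" using that by (simp add: frac_le)
      then have "ennreal (1 / Suc n) \<le> ennreal \<epsilon>" using N by (intro ennreal_leI) simp
      then show ?thesis using Y[of n] by (rule less_le_trans[rotated])
    qed
    then show ?thesis by blast
  qed
  have "Cauchy_norm1 \<Theta> Y"
    unfolding Cauchy_norm1_def
  proof (intro allI impI)
    fix \<epsilon> :: real assume "\<epsilon> > 0"
    then obtain N where N: "\<And>n. n \<ge> N \<Longrightarrow> dist1 (\<lambda>\<omega>. ereal (Y n \<omega>)) Z < ennreal (\<epsilon> / 2)"
      using lim[of "\<epsilon> / 2"] by auto
    have "dist1 (\<lambda>\<omega>. ereal (Y m \<omega>)) (\<lambda>\<omega>. ereal (Y n \<omega>)) < ennreal \<epsilon>" if "m \<ge> N" "n \<ge> N" for m n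
      using N[OF that(2)] by (intro dist1_triangle_less[OF YM ZM YM N[OF that(1)]]) (subst dist1_commute)
    then show "\<exists>N. \<forall>m\<ge>N. \<forall>n\<ge>N. norm1 \<Theta> (\<lambda>\<omega>. ereal (Y m \<omega> - Y n \<omega>)) < ereal \<epsilon>"
      using \<open>\<epsilon> > 0\<close> by (auto simp: norm1_less_iff[OF ne])
  qed
  then show ?L
    using R YB lim unfolding completion1_def by (auto simp: norm1_tendsto_0_iff[OF ne])
qed

lemma L1b_iff:
  assumes "\<Theta> \<noteq> {}"
  shows "Z \<in> L1b M \<Theta> H \<longleftrightarrow> Z \<in> H_ext M \<Theta> \<and>
    (\<forall>\<epsilon>>0. \<exists>Y\<in>H. (\<exists>C. \<forall>\<omega>\<in>space M. \<bar>Y \<omega>\<bar> \<le> C) \<and> dist1 (\<lambda>\<omega>. ereal (Y \<omega>)) Z < ennreal \<epsilon>)"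
  unfolding L1b_def by (subst completion1_iff[OF assms]) (simp_all add: Bex_def conj_assoc Collect_mono_iff subset_iff)

lemma L1b_measurable: "Z \<in> L1b M \<Theta> H \<Longrightarrow> Z \<in> borel_measurable M"
  by (simp add: L1b_def completion1_def H_ext_def)

text \<open>\<open>unif_integrable\<close> includes membership in \<open>L1\<close>. Because every
  \<theta> has mass 1, bounded functions have finite seminorm, so the same approximating sequence
  works for \<open>L1\<close>.\<close>

lemma L1b_subset_L1:
  assumes "\<Theta> \<noteq> {}"
  shows "L1b M \<Theta> H \<subseteq> L1 M \<Theta> H"
proof -
  have "norm1 \<Theta> (\<lambda>\<omega>. ereal (Y \<omega>)) < \<infinity>" if "\<forall>\<omega>\<in>space M. \<bar>Y \<omega>\<bar> \<le> C" for Y C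
  proof -
    have "upper_int \<Theta> (\<lambda>\<omega>. ennabs (ereal (Y \<omega>))) \<le> upper_int \<Theta> (\<lambda>_. ennreal C)"
      using that by (intro upper_int_mono) (auto intro!: ennreal_leI)
    also have "\<dots> < \<infinity>" by (rule le_less_trans[OF upper_int_const_le]) simp
    finally show ?thesis by (simp add: norm1_eq_upper_int[OF assms] less_ennreal.rep_eq)
  qed
  then show ?thesis unfolding L1b_def L1_def completion1_def by blast
qed

section \<open>Uniform integrability from approximation with a common bound\<close>

lemma ennabs_tail_le:
  assumes "\<bar>y\<bar> \<le> C" "2 * C \<le> c"
  shows "ennabs (indicator {\<omega> \<in> S. \<bar>X \<omega>\<bar> \<ge> ereal c} \<omega> * \<bar>X \<omega>\<bar>) \<le> 2 * ennabs (ereal y - X \<omega>)"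
proof (cases "X \<omega>")
  case (real x)
  show ?thesis
  proof (cases "\<bar>x\<bar> \<ge> c")
    case True
    \<comment> \<open>Here 2|y| \<le> 2C \<le> c \<le> |x|, so |y - x| \<ge> |x| - |y| \<ge>
      |x|/2.\<close>
    then have "ennreal \<bar>x\<bar> \<le> ennreal (2 * \<bar>y - x\<bar>)"
      using assms abs_triangle_ineq2[of x y] by (intro ennreal_leI) (simp add: abs_minus_commute)
    then show ?thesis using real by (auto simp: indicator_def ennreal_mult)
  qed (simp add: real)
\<comment> \<open>If \<open>X \<omega>\<close> is infinite, so is the right side.\<close>
qed (auto simp: e2ennreal_infty ennreal_mult_top)

text \<open>The quantifier order carries the content: \<open>C\<close> is chosen before
  \<open>X\<close>, so the tail threshold 2C is common to all of \<open>K\<close>.\<close>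

lemma unif_integrableI:
  assumes ne: "\<Theta> \<noteq> {}" and K: "K \<subseteq> L1b M \<Theta> H"
    and approx: "\<And>\<epsilon>. \<epsilon> > 0 \<Longrightarrow> \<exists>C. \<forall>X\<in>K. \<exists>Y\<in>H. (\<forall>\<omega>\<in>space M. \<bar>Y \<omega>\<bar> \<le> C) \<and>
      dist1 (\<lambda>\<omega>. ereal (Y \<omega>)) X < ennreal \<epsilon>"
  shows "unif_integrable M \<Theta> H K"
  unfolding unif_integrable_def
proof (intro conjI allI impI)
  show "K \<subseteq> L1 M \<Theta> H" using K L1b_subset_L1[OF ne] by blast
  fix \<epsilon> :: real assume "\<epsilon> > 0"
  \<comment> \<open>The tail estimate costs a factor 2, hence the approximation within
    \<epsilon>/2.\<close>
  then obtain C where C: "\<forall>X\<in>K. \<exists>Y\<in>H. (\<forall>\<omega>\<in>space M. \<bar>Y \<omega>\<bar> \<le> C) \<and>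
      dist1 (\<lambda>\<omega>. ereal (Y \<omega>)) X < ennreal (\<epsilon> / 2)"
    using approx[of "\<epsilon> / 2"] by auto
  have "E_ext \<Theta> (\<lambda>\<omega>. indicator {\<omega> \<in> space M. \<bar>X \<omega>\<bar> \<ge> ereal c} \<omega> * \<bar>X \<omega>\<bar>) < ereal \<epsilon>"
    if "2 * C \<le> c" "X \<in> K" for c X
  proof -
    obtain Y where Y: "Y \<in> H" "\<And>\<omega>. \<omega> \<in> space M \<Longrightarrow> \<bar>Y \<omega>\<bar> \<le> C"
        "dist1 (\<lambda>\<omega>. ereal (Y \<omega>)) X < ennreal (\<epsilon> / 2)"
      using C \<open>X \<in> K\<close> by blast
    have [measurable]: "X \<in> borel_measurable M" "Y \<in> borel_measurable M"
      using K \<open>X \<in> K\<close> L1b_measurable Y(1) H_measurable by auto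
    have "upper_int \<Theta> (\<lambda>\<omega>. ennabs (indicator {\<omega> \<in> space M. \<bar>X \<omega>\<bar> \<ge> ereal c} \<omega> * \<bar>X \<omega>\<bar>))
        \<le> upper_int \<Theta> (\<lambda>\<omega>. 2 * ennabs (ereal (Y \<omega>) - X \<omega>))"
      using Y(2) that(1) by (intro upper_int_mono ennabs_tail_le)
    also have "\<dots> = 2 * dist1 (\<lambda>\<omega>. ereal (Y \<omega>)) X"
      by (rule upper_int_cmult) measurable
    also have "\<dots> < ennreal \<epsilon>"
      using ennreal_half_add_less[OF Y(3) Y(3)] by (simp add: mult_2)
    finally show ?thesis
      using \<open>\<epsilon> > 0\<close> by (subst E_ext_eq_norm1) (auto simp: norm1_less_iff[OF ne] indicator_def)
  qed
  then show "\<exists>c0. \<forall>c\<ge>c0. \<forall>X\<in>K.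
      E_ext \<Theta> (\<lambda>\<omega>. indicator {\<omega> \<in> space M. \<bar>X \<omega>\<bar> \<ge> ereal c} \<omega> * \<bar>X \<omega>\<bar>) < ereal \<epsilon>"
    by (intro exI[of _ "2 * C"]) blast
qed

section \<open>Capacity and Markov's inequality\<close>

text \<open>On measurable sets this is the upper probability, the supremum of \<theta>(A) over
  \<Theta>.\<close>

definition capacity :: "'a set \<Rightarrow> ennreal" where
  "capacity A = upper_int \<Theta> (indicator A)"

lemma converges_in_capacity_iff:
  assumes ne: "\<Theta> \<noteq> {}"
  shows "converges_in_capacity M \<Theta> X Z \<longleftrightarrow>
    (\<forall>\<epsilon>>0. \<forall>\<delta>>0. \<exists>N. \<forall>m\<ge>N. capacity {\<omega>\<in>space M. ennabs (X m \<omega> - Z \<omega>) > ennreal \<epsilon>} < ennreal \<delta>)"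
proof -
  have "E_ext \<Theta> (indicator A) < ereal \<delta> \<longleftrightarrow> capacity A < ennreal \<delta>" if "\<delta> > 0" for A \<delta>
  proof -
    have "ennabs (indicator A \<omega>) = indicator A \<omega>" for \<omega>
      by (auto simp: indicator_def one_ennreal.abs_eq)
    then show ?thesis
      using that by (subst E_ext_eq_norm1) (auto simp: norm1_less_iff[OF ne] capacity_def)
  qed
  moreover have "ennabs x > ennreal \<epsilon> \<longleftrightarrow> \<bar>x\<bar> > ereal \<epsilon>" if "\<epsilon> > 0" for x \<epsilon>
    using that by (cases x) (auto simp: e2ennreal_infty ennreal_less_iff)
  ultimately show ?thesis
    unfolding converges_in_capacity_def by simp
qed

text \<open>Markov's inequality holds under each \<theta>, and both sides pass to the supremum; the
  product form avoids division in \<open>ennreal\<close>.\<close>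

lemma capacity_Markov:
  assumes "f \<in> borel_measurable M" "\<epsilon> > 0"
  shows "ennreal \<epsilon> * capacity {\<omega>\<in>space M. f \<omega> > ennreal \<epsilon>} \<le> upper_int \<Theta> f"
proof -
  have "ennreal \<epsilon> * capacity {\<omega>\<in>space M. f \<omega> > ennreal \<epsilon>}
      = upper_int \<Theta> (\<lambda>\<omega>. ennreal \<epsilon> * indicator {\<omega>\<in>space M. f \<omega> > ennreal \<epsilon>} \<omega>)"
    unfolding capacity_def using assms(1) by (intro upper_int_cmult[symmetric]) measurable
  also have "\<dots> \<le> upper_int \<Theta> f"
    by (intro upper_int_mono) (auto simp: indicator_def)
  finally show ?thesis .
qed

lemma converges_in_L1_imp_capacity:
  assumes ne: "\<Theta> \<noteq> {}"
    and XM: "\<And>n. X n \<in> borel_measurable M" and ZM: "Z \<in> borel_measurable M"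
    and lim: "converges_in_L1 \<Theta> X Z"
  shows "converges_in_capacity M \<Theta> X Z"
  unfolding converges_in_capacity_iff[OF ne]
proof (intro allI impI)
  fix \<epsilon> \<delta> :: real assume pos: "\<epsilon> > 0" "\<delta> > 0"
  \<comment> \<open>The accuracy \<epsilon>\<delta> leaves \<delta> once Markov's factor \<epsilon>
    is cancelled.\<close>
  then obtain N where N: "\<And>n. n \<ge> N \<Longrightarrow> dist1 (X n) Z < ennreal (\<epsilon> * \<delta>)"
    using lim unfolding converges_in_L1_def norm1_tendsto_0_iff[OF ne] by (meson mult_pos_pos)
  have "capacity {\<omega>\<in>space M. ennabs (X n \<omega> - Z \<omega>) > ennreal \<epsilon>} < ennreal \<delta>" if "n \<ge> N" for n
  proof -
    have "ennreal \<epsilon> * capacity {\<omega>\<in>space M. ennabs (X n \<omega> - Z \<omega>) > ennreal \<epsilon>} \<le> dist1 (X n) Z"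
      using XM[of n] ZM pos by (intro capacity_Markov) measurable
    also have "\<dots> < ennreal \<epsilon> * ennreal \<delta>"
      using N[OF that] pos by (simp add: ennreal_mult)
    \<comment> \<open>Cancellation by contraposition: a capacity of at least \<delta> would give a
      product of at least \<epsilon>\<delta>.\<close>
    finally show ?thesis
      by (meson mult_left_mono not_le zero_le)
  qed
  then show "\<exists>N. \<forall>m\<ge>N. capacity {\<omega>\<in>space M. ennabs (X m \<omega> - Z \<omega>) > ennreal \<epsilon>} < ennreal \<delta>"
    by blast
qed

section \<open>The forward direction: closedness of \<open>L1b\<close> and uniform integrability of
  convergent sequences\<close>

lemma L1b_closed:
  assumes ne: "\<Theta> \<noteq> {}" and X: "\<And>n. X n \<in> L1b M \<Theta> H" and Z: "Z \<in> H_ext M \<Theta>"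
    and lim: "converges_in_L1 \<Theta> X Z"
  shows "Z \<in> L1b M \<Theta> H"
  unfolding L1b_iff[OF ne]
proof (intro conjI allI impI Z)
  fix \<epsilon> :: real assume "\<epsilon> > 0"
  then obtain n where n: "dist1 (X n) Z < ennreal (\<epsilon> / 2)"
    using lim unfolding converges_in_L1_def norm1_tendsto_0_iff[OF ne] by (meson half_gt_zero order_refl)
  obtain Y where Y: "Y \<in> H" "\<exists>C. \<forall>\<omega>\<in>space M. \<bar>Y \<omega>\<bar> \<le> C"
      "dist1 (\<lambda>\<omega>. ereal (Y \<omega>)) (X n) < ennreal (\<epsilon> / 2)"
    using X[of n] \<open>\<epsilon> > 0\<close> unfolding L1b_iff[OF ne] by (meson half_gt_zero)
  have "dist1 (\<lambda>\<omega>. ereal (Y \<omega>)) Z < ennreal \<epsilon>"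
    using Y(1) Z L1b_measurable[OF X] H_measurable
    by (intro dist1_triangle_less[OF _ _ _ Y(3) n]) (auto simp: H_ext_def)
  with Y show "\<exists>Y\<in>H. (\<exists>C. \<forall>\<omega>\<in>space M. \<bar>Y \<omega>\<bar> \<le> C) \<and> dist1 (\<lambda>\<omega>. ereal (Y \<omega>)) Z < ennreal \<epsilon>"
    by blast
qed

text \<open>A common bound is found in two pieces: all \<open>X n\<close> with n \<ge> N lie within
  \<epsilon>/2 of \<open>Z\<close> and can share the approximant \<open>Y'\<close> of
  \<open>Z\<close>, while the finitely many earlier terms keep their own approximants.\<close>

lemma converges_in_L1_imp_unif_integrable:
  assumes ne: "\<Theta> \<noteq> {}" and X: "\<And>n. X n \<in> L1b M \<Theta> H" and Z: "Z \<in> L1b M \<Theta> H"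
    and lim: "converges_in_L1 \<Theta> X Z"
  shows "unif_integrable M \<Theta> H (range X \<union> {Z})"
proof (rule unif_integrableI[OF ne])
  show "range X \<union> {Z} \<subseteq> L1b M \<Theta> H" using X Z by auto
  fix \<epsilon> :: real assume "\<epsilon> > 0"
  have bdd: "\<exists>C Y. Y \<in> H \<and> (\<forall>\<omega>\<in>space M. \<bar>Y \<omega>\<bar> \<le> C) \<and> dist1 (\<lambda>\<omega>. ereal (Y \<omega>)) W < ennreal (\<epsilon> / 2)"
    if "W \<in> L1b M \<Theta> H" for W
    using that \<open>\<epsilon> > 0\<close> unfolding L1b_iff[OF ne] by (meson half_gt_zero)
  have "\<forall>n. \<exists>C Y. Y \<in> H \<and> (\<forall>\<omega>\<in>space M. \<bar>Y \<omega>\<bar> \<le> C) \<and> dist1 (\<lambda>\<omega>. ereal (Y \<omega>)) (X n) < ennreal (\<epsilon> / 2)"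
    using bdd X by blast
  then obtain C Y where Y: "\<And>n. Y n \<in> H" "\<And>n \<omega>. \<omega> \<in> space M \<Longrightarrow> \<bar>Y n \<omega>\<bar> \<le> C n"
      "\<And>n. dist1 (\<lambda>\<omega>. ereal (Y n \<omega>)) (X n) < ennreal (\<epsilon> / 2)"
    by metis
  obtain C' Y' where Y': "Y' \<in> H" "\<And>\<omega>. \<omega> \<in> space M \<Longrightarrow> \<bar>Y' \<omega>\<bar> \<le> C'"
      "dist1 (\<lambda>\<omega>. ereal (Y' \<omega>)) Z < ennreal (\<epsilon> / 2)"
    using bdd[OF Z] by blast
  obtain N where N: "\<And>n. n \<ge> N \<Longrightarrow> dist1 (X n) Z < ennreal (\<epsilon> / 2)"
    using lim \<open>\<epsilon> > 0\<close> unfolding converges_in_L1_def norm1_tendsto_0_iff[OF ne] by (meson half_gt_zero)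
  have half_le: "ennreal (\<epsilon> / 2) \<le> ennreal \<epsilon>" using \<open>\<epsilon> > 0\<close> by (intro ennreal_leI) simp
  \<comment> \<open>Inserting \<open>C'\<close> covers \<open>Z\<close> and the late terms, and
    keeps the set nonempty when N = 0.\<close>
  define D where "D = Max (insert C' (C ` {..<N}))"
  have D: "C' \<le> D" "\<And>n. n < N \<Longrightarrow> C n \<le> D" by (auto simp: D_def)
  then have bdd_Z: "\<forall>\<omega>\<in>space M. \<bar>Y' \<omega>\<bar> \<le> D" using Y'(2) order_trans by blast
  have small: "\<exists>V\<in>H. (\<forall>\<omega>\<in>space M. \<bar>V \<omega>\<bar> \<le> D) \<and> dist1 (\<lambda>\<omega>. ereal (V \<omega>)) (X n) < ennreal \<epsilon>" for n
  proof (cases "n < N")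
    case True
    then have "\<forall>\<omega>\<in>space M. \<bar>Y n \<omega>\<bar> \<le> D"
      using Y(2) D(2) order_trans by blast
    then show ?thesis
      using Y(1) less_le_trans[OF Y(3) half_le] by blast
  next
    case False
    then have "dist1 (X n) Z < ennreal (\<epsilon> / 2)" using N by simp
    then have "dist1 Z (X n) < ennreal (\<epsilon> / 2)" by (subst dist1_commute)
    then have "dist1 (\<lambda>\<omega>. ereal (Y' \<omega>)) (X n) < ennreal \<epsilon>"
      using Y'(1) L1b_measurable[OF X[of n]] L1b_measurable[OF Z] H_measurable
      by (intro dist1_triangle_less[OF _ _ _ Y'(3)]) auto
    then show ?thesis
      using Y'(1) bdd_Z by blast
  qed
  moreover have "\<exists>V\<in>H. (\<forall>\<omega>\<in>space M. \<bar>V \<omega>\<bar> \<le> D) \<and> dist1 (\<lambda>\<omega>. ereal (V \<omega>)) Z < ennreal \<epsilon>"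
    using Y'(1) bdd_Z less_le_trans[OF Y'(3) half_le] by blast
  ultimately show "\<exists>C. \<forall>W\<in>range X \<union> {Z}. \<exists>Y\<in>H. (\<forall>\<omega>\<in>space M. \<bar>Y \<omega>\<bar> \<le> C) \<and>
      dist1 (\<lambda>\<omega>. ereal (Y \<omega>)) W < ennreal \<epsilon>"
    by (intro exI[of _ D]) auto
qed

section \<open>The converse: from uniform integrability and capacity to a Cauchy sequence\<close>

text \<open>Where the two functions differ by more than \<open>2\<epsilon>\<close>, one of them is \<open>\<epsilon>\<close>-far from \<open>z\<close>.\<close>

lemma ennabs_diff_le_tails:
  assumes "\<epsilon> > 0" "c \<ge> 0"
  shows "ennabs (x - y) \<le> ennreal (2 * \<epsilon>)
      + ennreal (2 * c) * (of_bool (ennabs (x - z) > ennreal \<epsilon>) + of_bool (ennabs (y - z) > ennreal \<epsilon>))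
      + (of_bool (\<bar>x\<bar> \<ge> ereal c) * ennabs x + of_bool (\<bar>y\<bar> \<ge> ereal c) * ennabs y)"
proof (cases "ennabs (x - z) > ennreal \<epsilon> \<or> ennabs (y - z) > ennreal \<epsilon>")
  case False
  have "ennabs (x - y) \<le> ennabs (x - z) + ennabs (y - z)"
    using ennabs_diff_triangle[of x y z] by (simp add: ennabs_diff_commute[of z y])
  also have "\<dots> \<le> ennreal \<epsilon> + ennreal \<epsilon>" using False by (intro add_mono) auto
  also have "\<dots> = ennreal (2 * \<epsilon>)" using assms by (simp flip: ennreal_plus)
  finally show ?thesis by (simp add: add_increasing2)
next
  case True
  have tail: "ennabs u \<le> ennreal c + of_bool (\<bar>u\<bar> \<ge> ereal c) * ennabs u" for u
    using assms by (cases u) (auto intro!: ennreal_leI simp: e2ennreal_infty)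
  have "ennabs (x - y) \<le> ennabs x + ennabs y"
    using ennabs_diff_triangle[of x y 0] by simp
  also have "\<dots> \<le> (ennreal c + of_bool (\<bar>x\<bar> \<ge> ereal c) * ennabs x)
      + (ennreal c + of_bool (\<bar>y\<bar> \<ge> ereal c) * ennabs y)"
    by (intro add_mono tail)
  \<comment> \<open>In this case at least one of the two indicators is 1, so the factor 1 split off
    here is at most their sum.\<close>
  also have "\<dots> = ennreal (2 * c) * 1 + (of_bool (\<bar>x\<bar> \<ge> ereal c) * ennabs x + of_bool (\<bar>y\<bar> \<ge> ereal c) * ennabs y)"
  proof -
    have "ennreal (2 * c) = ennreal c + ennreal c" using assms by (simp flip: ennreal_plus)
    then show ?thesis by (simp add: ac_simps)
  qed
  also have "\<dots> \<le> ennreal (2 * c) * (of_bool (ennabs (x - z) > ennreal \<epsilon>) + of_bool (ennabs (y - z) > ennreal \<epsilon>))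
      + (of_bool (\<bar>x\<bar> \<ge> ereal c) * ennabs x + of_bool (\<bar>y\<bar> \<ge> ereal c) * ennabs y)"
    using True by (intro add_mono mult_left_mono) auto
  also have "\<dots> \<le> ennreal (2 * \<epsilon>) + \<dots>" by simp
  finally show ?thesis by (simp only: add.assoc)
qed

text \<open>Recasts the tail condition as a product of \<open>of_bool\<close> and
  \<open>ennabs\<close>, the form in which the tails occur in
  \<open>ennabs_diff_le_tails\<close>.\<close>

lemma unif_integrable_tail:
  assumes ne: "\<Theta> \<noteq> {}" and "unif_integrable M \<Theta> H K" "\<epsilon> > 0"
  shows "\<exists>c\<ge>0. \<forall>X\<in>K. upper_int \<Theta> (\<lambda>\<omega>. of_bool (\<bar>X \<omega>\<bar> \<ge> ereal c) * ennabs (X \<omega>)) < ennreal \<epsilon>"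
proof -
  obtain c0 :: real where c0: "\<And>c X. c \<ge> c0 \<Longrightarrow> X \<in> K \<Longrightarrow>
      E_ext \<Theta> (\<lambda>\<omega>. indicator {\<omega> \<in> space M. \<bar>X \<omega>\<bar> \<ge> ereal c} \<omega> * \<bar>X \<omega>\<bar>) < ereal \<epsilon>"
    using assms(2,3) unfolding unif_integrable_def by meson
  \<comment> \<open>A larger threshold is still admissible, and nonnegativity is what
    \<open>ennabs_diff_le_tails\<close> asks for.\<close>
  define c where "c = max c0 0"
  have "upper_int \<Theta> (\<lambda>\<omega>. of_bool (\<bar>X \<omega>\<bar> \<ge> ereal c) * ennabs (X \<omega>)) < ennreal \<epsilon>" if "X \<in> K" for X
  proof -
    have "E_ext \<Theta> (\<lambda>\<omega>. indicator {\<omega> \<in> space M. \<bar>X \<omega>\<bar> \<ge> ereal c} \<omega> * \<bar>X \<omega>\<bar>)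
        = norm1 \<Theta> (\<lambda>\<omega>. indicator {\<omega> \<in> space M. \<bar>X \<omega>\<bar> \<ge> ereal c} \<omega> * \<bar>X \<omega>\<bar>)"
      by (rule E_ext_eq_norm1) (simp add: indicator_def)
    then have "norm1 \<Theta> (\<lambda>\<omega>. indicator {\<omega> \<in> space M. \<bar>X \<omega>\<bar> \<ge> ereal c} \<omega> * \<bar>X \<omega>\<bar>) < ereal \<epsilon>"
      using c0[of c, OF _ that] by (simp add: c_def)
    then have "upper_int \<Theta> (\<lambda>\<omega>. ennabs (indicator {\<omega> \<in> space M. \<bar>X \<omega>\<bar> \<ge> ereal c} \<omega> * \<bar>X \<omega>\<bar>)) < ennreal \<epsilon>"
      using assms(3) by (simp add: norm1_less_iff[OF ne])
    moreover have "upper_int \<Theta> (\<lambda>\<omega>. of_bool (\<bar>X \<omega>\<bar> \<ge> ereal c) * ennabs (X \<omega>))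
        \<le> upper_int \<Theta> (\<lambda>\<omega>. ennabs (indicator {\<omega> \<in> space M. \<bar>X \<omega>\<bar> \<ge> ereal c} \<omega> * \<bar>X \<omega>\<bar>))"
      by (intro upper_int_mono) (auto simp: indicator_def)
    ultimately show ?thesis by (rule le_less_trans[rotated])
  qed
  then show ?thesis by (intro exI[of _ c]) (auto simp: c_def)
qed

lemma capacity_eq_of_bool:
  "upper_int \<Theta> (\<lambda>\<omega>. of_bool (P \<omega>)) = capacity {\<omega>\<in>space M. P \<omega>}"
  unfolding capacity_def by (intro antisym upper_int_mono) (auto simp: indicator_def)

text \<open>The order of choices matters: uniform integrability fixes \<open>c\<close> first, and
  only then is \<open>N\<close> chosen so that the capacities are small compared with 1/(2c +
  1).\<close>

lemma unif_integrable_capacity_imp_Cauchy: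
  assumes ne: "\<Theta> \<noteq> {}"
    and XM[measurable]: "\<And>n. X n \<in> borel_measurable M" and ZM[measurable]: "Z \<in> borel_measurable M"
    and ui: "unif_integrable M \<Theta> H (range X)" and cap: "converges_in_capacity M \<Theta> X Z"
    and "\<eta> > 0"
  shows "\<exists>N. \<forall>m\<ge>N. \<forall>n\<ge>N. dist1 (X m) (X n) \<le> ennreal \<eta>"
proof -
  \<comment> \<open>Six errors of size \<epsilon> add up: 2\<epsilon> from the region where both
    functions are close to \<open>Z\<close>, one for each capacity term and one for each
    tail.\<close>
  define \<epsilon> where "\<epsilon> = \<eta> / 6"
  have \<epsilon>: "\<epsilon> > 0" using \<open>\<eta> > 0\<close> by (simp add: \<epsilon>_def)
  define T where "T c n = upper_int \<Theta> (\<lambda>\<omega>. of_bool (\<bar>X n \<omega>\<bar> \<ge> ereal c) * ennabs (X n \<omega>))" for c n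
  define A where "A n = upper_int \<Theta> (\<lambda>\<omega>. of_bool (ennabs (X n \<omega> - Z \<omega>) > ennreal \<epsilon>))" for n
  obtain c where c: "c \<ge> 0" "\<And>n. T c n < ennreal \<epsilon>"
    using unif_integrable_tail[OF ne ui \<epsilon>] unfolding T_def by blast
  \<comment> \<open>The summand 1 keeps the denominator positive when c = 0, and 2c\<epsilon>/(2c +
    1) \<le> \<epsilon>.\<close>
  obtain N where N: "\<And>n. n \<ge> N \<Longrightarrow> A n < ennreal (\<epsilon> / (2 * c + 1))"
    using cap \<epsilon> c(1) unfolding converges_in_capacity_iff[OF ne] A_def capacity_eq_of_bool
    by (meson add_nonneg_pos divide_pos_pos mult_nonneg_nonneg zero_le_numeral zero_less_one)
  have cA: "ennreal (2 * c) * A n \<le> ennreal \<epsilon>" if "n \<ge> N" for n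
  proof -
    have "ennreal (2 * c) * A n \<le> ennreal (2 * c) * ennreal (\<epsilon> / (2 * c + 1))"
      using N[OF that] by (intro mult_left_mono) auto
    also have "\<dots> = ennreal (2 * c * (\<epsilon> / (2 * c + 1)))"
      using c(1) \<epsilon> by (intro ennreal_mult[symmetric]) auto
    also have "\<dots> \<le> ennreal \<epsilon>"
      using c(1) \<epsilon> by (intro ennreal_leI) (simp add: field_simps)
    finally show ?thesis .
  qed
  have "dist1 (X m) (X n) \<le> ennreal \<eta>" if "m \<ge> N" "n \<ge> N" for m n
  proof -
    let ?a = "\<lambda>n \<omega>. of_bool (ennabs (X n \<omega> - Z \<omega>) > ennreal \<epsilon>) :: ennreal"
    let ?t = "\<lambda>n \<omega>. of_bool (\<bar>X n \<omega>\<bar> \<ge> ereal c) * ennabs (X n \<omega>)"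
    have "dist1 (X m) (X n) \<le> upper_int \<Theta> (\<lambda>\<omega>. (ennreal (2 * \<epsilon>)
        + ennreal (2 * c) * (?a m \<omega> + ?a n \<omega>)) + (?t m \<omega> + ?t n \<omega>))"
      by (intro upper_int_mono ennabs_diff_le_tails \<epsilon> c)
    also have "\<dots> \<le> upper_int \<Theta> (\<lambda>\<omega>. ennreal (2 * \<epsilon>) + ennreal (2 * c) * (?a m \<omega> + ?a n \<omega>))
        + upper_int \<Theta> (\<lambda>\<omega>. ?t m \<omega> + ?t n \<omega>)"
      by (rule upper_int_add_le) measurable
    also have "\<dots> \<le> (upper_int \<Theta> (\<lambda>\<omega>. ennreal (2 * \<epsilon>)) + upper_int \<Theta> (\<lambda>\<omega>. ennreal (2 * c) * (?a m \<omega> + ?a n \<omega>)))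
        + (T c m + T c n)"
      unfolding T_def by (intro add_mono upper_int_add_le) measurable
    also have "\<dots> \<le> (ennreal (2 * \<epsilon>) + ennreal (2 * c) * (A m + A n)) + (T c m + T c n)"
    proof -
      have "upper_int \<Theta> (\<lambda>\<omega>. ennreal (2 * c) * (?a m \<omega> + ?a n \<omega>))
          = ennreal (2 * c) * upper_int \<Theta> (\<lambda>\<omega>. ?a m \<omega> + ?a n \<omega>)"
        by (rule upper_int_cmult) measurable
      also have "\<dots> \<le> ennreal (2 * c) * (A m + A n)"
        unfolding A_def by (rule mult_left_mono[OF upper_int_add_le]) simp_all
      finally show ?thesis by (intro add_mono upper_int_const_le order_refl)
    qed
    also have "\<dots> \<le> (ennreal (2 * \<epsilon>) + (ennreal \<epsilon> + ennreal \<epsilon>)) + (ennreal \<epsilon> + ennreal \<epsilon>)"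
      unfolding distrib_left by (intro add_mono order_refl cA that less_imp_le[OF c(2)])
    also have "\<dots> = ennreal \<eta>"
      using \<epsilon> by (simp add: \<epsilon>_def flip: ennreal_plus)
    finally show ?thesis .
  qed
  then show ?thesis by blast
qed

section \<open>Identifying the limit with \<open>Z\<close>\<close>

lemma unif_integrable_capacity_imp_L1:
  assumes ne: "\<Theta> \<noteq> {}"
    and XM[measurable]: "\<And>n. X n \<in> borel_measurable M" and ZM[measurable]: "Z \<in> borel_measurable M"
    and ui: "unif_integrable M \<Theta> H (range X)" and cap: "converges_in_capacity M \<Theta> X Z"
  shows "converges_in_L1 \<Theta> X Z"
  unfolding converges_in_L1_def norm1_tendsto_0_iff[OF ne]
proof (intro allI impI)
  fix \<eta> :: real assume "\<eta> > 0"
  \<comment> \<open>The truncated distances will be at most 3\<epsilon>; the fourth quarter yields a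
    strict inequality after the supremum.\<close>
  define \<epsilon> where "\<epsilon> = \<eta> / 4"
  have \<epsilon>: "\<epsilon> > 0" using \<open>\<eta> > 0\<close> by (simp add: \<epsilon>_def)
  obtain N where N: "\<And>m n. m \<ge> N \<Longrightarrow> n \<ge> N \<Longrightarrow> dist1 (X m) (X n) \<le> ennreal \<epsilon>"
    using unif_integrable_capacity_imp_Cauchy[OF ne XM ZM ui cap \<epsilon>] by blast
  have "dist1 (X n) Z < ennreal \<eta>" if n: "n \<ge> N" for n
  proof -
    \<comment> \<open>The bound must be uniform in \<open>k\<close>, since \<open>k\<close> tends to
      infinity afterwards.\<close>
    have trunc: "upper_int \<Theta> (\<lambda>\<omega>. min (ennabs (X n \<omega> - Z \<omega>)) (of_nat k)) \<le> ennreal (3 * \<epsilon>)" for k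
    proof -
      let ?a = "\<lambda>m \<omega>. of_bool (ennabs (X m \<omega> - Z \<omega>) > ennreal \<epsilon>) :: ennreal"
      \<comment> \<open>\<open>N'\<close> may depend on \<open>k\<close>; a capacity below
        \<epsilon>/(k + 1) contributes at most \<epsilon> after multiplication by \<open>k\<close>,
        with k = 0 included.\<close>
      obtain N' where N': "\<And>m. m \<ge> N' \<Longrightarrow> upper_int \<Theta> (?a m) < ennreal (\<epsilon> / (k + 1))"
        using cap[unfolded converges_in_capacity_iff[OF ne], rule_format, of \<epsilon> "\<epsilon> / (k + 1)"] \<epsilon>
        unfolding capacity_eq_of_bool by auto
      \<comment> \<open>\<open>X m\<close> is only an intermediary: m \<ge> N puts it within
        \<epsilon> of \<open>X n\<close>, m \<ge> N' makes it close to \<open>Z\<close> in capacity,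
        and \<open>m\<close> is absent from the final bound.\<close>
      define m where "m = max N N'"
      have "upper_int \<Theta> (\<lambda>\<omega>. min (ennabs (X n \<omega> - Z \<omega>)) (of_nat k))
          \<le> upper_int \<Theta> (\<lambda>\<omega>. (ennabs (X n \<omega> - X m \<omega>) + ennreal \<epsilon>) + of_nat k * ?a m \<omega>)"
      proof (rule upper_int_mono)
        fix \<omega>
        show "min (ennabs (X n \<omega> - Z \<omega>)) (of_nat k)
            \<le> (ennabs (X n \<omega> - X m \<omega>) + ennreal \<epsilon>) + of_nat k * ?a m \<omega>"
        proof (cases "ennabs (X m \<omega> - Z \<omega>) > ennreal \<epsilon>")
          case True
          then show ?thesis by (simp add: min.coboundedI2 add_increasing)
        next
          case False
          then have "ennabs (X n \<omega> - Z \<omega>) \<le> ennabs (X n \<omega> - X m \<omega>) + ennreal \<epsilon>"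
            using ennabs_diff_triangle[of "X n \<omega>" "Z \<omega>" "X m \<omega>"]
            by (meson add_left_mono not_le order_trans)
          then show ?thesis using False by (simp add: min.coboundedI1)
        qed
      qed
      also have "\<dots> \<le> upper_int \<Theta> (\<lambda>\<omega>. ennabs (X n \<omega> - X m \<omega>) + ennreal \<epsilon>)
          + upper_int \<Theta> (\<lambda>\<omega>. of_nat k * ?a m \<omega>)"
        by (rule upper_int_add_le) measurable
      also have "\<dots> \<le> (dist1 (X n) (X m) + upper_int \<Theta> (\<lambda>_. ennreal \<epsilon>)) + of_nat k * upper_int \<Theta> (?a m)"
        by (intro add_mono upper_int_add_le eq_refl upper_int_cmult) measurable
      also have "\<dots> \<le> (ennreal \<epsilon> + ennreal \<epsilon>) + of_nat k * ennreal (\<epsilon> / (k + 1))"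
        using N'[of m] N[OF n, of m]
        by (intro add_mono mult_left_mono upper_int_const_le) (auto simp: m_def)
      also have "\<dots> = ennreal (2 * \<epsilon> + k * (\<epsilon> / (k + 1)))"
      proof -
        have "of_nat k * ennreal (\<epsilon> / (k + 1)) = ennreal (k * (\<epsilon> / (k + 1)))"
          unfolding ennreal_of_nat_eq_real_of_nat using \<epsilon> by (intro ennreal_mult[symmetric]) auto
        then show ?thesis using \<epsilon> by (simp flip: ennreal_plus)
      qed
      also have "\<dots> \<le> ennreal (3 * \<epsilon>)"
        using \<epsilon> by (intro ennreal_leI) (simp add: field_simps)
      finally show ?thesis .
    qed
    \<comment> \<open>This includes x = \<infinity>, as the naturals have supremum \<infinity> in
      \<open>ennreal\<close>.\<close>
    have sup: "(SUP k. min x (of_nat k)) = x" for x :: ennreal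
    proof -
      have "(SUP k. inf x (of_nat k)) = inf x (SUP k. of_nat k)"
        by (rule inf_SUP[symmetric])
      then show ?thesis by (simp add: ennreal_SUP_of_nat_eq_top inf_min)
    qed
    have "upper_int \<Theta> (\<lambda>\<omega>. SUP k. min (ennabs (X n \<omega> - Z \<omega>)) (of_nat k)) \<le> ennreal (3 * \<epsilon>)"
    proof (rule upper_int_SUP_le[OF _ _ trunc])
      show "incseq (\<lambda>k. min (ennabs (X n \<omega> - Z \<omega>)) (of_nat k))" for \<omega>
        by (intro monoI min.mono) auto
    qed measurable
    then have "dist1 (X n) Z \<le> ennreal (3 * \<epsilon>)" by (simp add: sup)
    also have "\<dots> < ennreal \<eta>" using \<open>\<eta> > 0\<close> by (simp add: \<epsilon>_def ennreal_less_iff)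
    finally show ?thesis .
  qed
  then show "\<exists>N. \<forall>n\<ge>N. dist1 (X n) Z < ennreal \<eta>" by blast
qed

end

section \<open>Nonemptiness of \<Theta> and assembly of the equivalence\<close>

text \<open>With \<Theta> empty every value of \<open>norm1\<close> is the empty supremum
  -\<infinity>, and the constant sequence -\<infinity> does not tend to 0.\<close>

lemma completion1_imp_nonempty:
  assumes "X \<in> completion1 M \<Theta> B"
  shows "\<Theta> \<noteq> {}"
proof
  assume "\<Theta> = {}"
  then have "(\<lambda>n::nat. - \<infinity> :: ereal) \<longlonglongrightarrow> 0"
    using assms by (auto simp: completion1_def norm1_eq bot_ereal_def)
  then show False by (simp add: LIMSEQ_const_iff)
qed

lemma unif_integrable_subset:
  "unif_integrable M \<Theta> H K \<Longrightarrow> L \<subseteq> K \<Longrightarrow> unif_integrable M \<Theta> H L"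
  unfolding unif_integrable_def by (meson subset_iff)

theorem theorem3p2:
  fixes M :: "'a measure" and F :: "nat \<Rightarrow> 'a measure"
    and H :: "('a \<Rightarrow> real) set" and E :: "nat \<Rightarrow> ('a \<Rightarrow> real) \<Rightarrow> 'a \<Rightarrow> real"
    and \<Theta> :: "'a measure set"
    and X :: "nat \<Rightarrow> 'a \<Rightarrow> ereal" and Z :: "'a \<Rightarrow> ereal"
  assumes "represented_SL_expectation M F H E \<Theta>"
    and "\<And>n. X n \<in> L1b M \<Theta> H"
    and "Z \<in> H_ext M \<Theta>"
  shows "(converges_in_L1 \<Theta> X Z \<longleftrightarrow>
            unif_integrable M \<Theta> H (range X) \<and> converges_in_capacity M \<Theta> X Z)
       \<and> (converges_in_L1 \<Theta> X Z \<longrightarrow>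
            unif_integrable M \<Theta> H (range X \<union> {Z}) \<and> Z \<in> L1b M \<Theta> H)"
proof -
  interpret represented_SL_expectation M F H E \<Theta> by (rule assms(1))
  have ne: "\<Theta> \<noteq> {}"
    using assms(2) unfolding L1b_def by (rule completion1_imp_nonempty)
  have XM: "X n \<in> borel_measurable M" for n by (rule L1b_measurable[OF assms(2)])
  have ZM: "Z \<in> borel_measurable M" using assms(3) by (simp add: H_ext_def)
  \<comment> \<open>\<open>L1b_closed\<close> comes first, because uniform integrability of the
    enlarged family is derived from \<open>Z\<close> being in \<open>L1b\<close>.\<close>
  have limit: "unif_integrable M \<Theta> H (range X \<union> {Z}) \<and> Z \<in> L1b M \<Theta> H" if "converges_in_L1 \<Theta> X Z"
    using L1b_closed[OF ne assms(2,3) that] converges_in_L1_imp_unif_integrable[OF ne assms(2) _ that]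
    by blast
  then have "unif_integrable M \<Theta> H (range X)" if "converges_in_L1 \<Theta> X Z"
    using that unif_integrable_subset by blast
  then show ?thesis
    using limit converges_in_L1_imp_capacity[where X = X, OF ne XM ZM]
      unif_integrable_capacity_imp_L1[where X = X, OF ne XM ZM]
    by blast
qed

end
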